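(* Let $k\ge 2$. A complete system of representatives of $\mathbb{Z}^{2k-1}/\sim$ (i.e. a subset containing exactly one element of each $\sim$-class) is given by the disjoint union $$\{(x,\dots,x)\in\mathbb{Z}^{2k-1}\mid x\in\mathbb{Z}\}\sqcup\bigsqcup_{p=1}^{k-1}C_p,$$ where for $1\le p\le k-1$ $$C_p=\Bigl\{(\underbrace{x,\dots,x}_{2p-1},\underbrace{y,\dots,y}_{2k-2p})\in\mathbb{Z}^{2k-1}\Bigm| x<y\Bigr\}.$$
   Context: For $m\ge2$, $B_m$ is the $m$-braid group with standard generators $\sigma_1,\dots,\sigma_{m-1}$ (relations $\sigma_i\sigma_j=\sigma_j\sigma_i$ for $|i-j|\ge2$ and $\sigma_i\sigma_{i+1}\sigma_i=\sigma_{i+1}\sigma_i\sigma_{i+1}$). It acts on $\mathbb{Z}^m$ on the right by the Hurwitz action $(a_1,\dots,a_m)\cdot\sigma_i=(a_1,\dots,a_{i-1},a_{i+1},2a_{i+1}-a_i,a_{i+2},\dots,a_m)$. For $v,w\in\mathbb{Z}^m$, $v\sim w$ means that $v\cdot\beta=w$ for some $\beta\in B_m$. *)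

theory Defs
  imports "HOL-Algebra.Group" "HOL-Library.Disjoint_Sets"
begin

text \<open>The braid group is given by its standard presentation: words in the letters
  \<open>(i, True)\<close>, standing for \<open>\<sigma>\<^sub>i\<close>, and \<open>(i, False)\<close>, standing for the inverse
  of \<open>\<sigma>\<^sub>i\<close>, with \<open>1 \<le> i < m\<close>, modulo the congruence generated by free cancellation
  and the braid relations.\<close>

type_synonym braid_word = "(nat \<times> bool) list"

definition braid_words :: "nat \<Rightarrow> braid_word set" where
  "braid_words m = lists ({1..<m} \<times> UNIV)"

inductive braid_eq :: "nat \<Rightarrow> braid_word \<Rightarrow> braid_word \<Rightarrow> bool" for m :: nat where
  refl: "u \<in> braid_words m \<Longrightarrow> braid_eq m u u"
| sym: "braid_eq m u v \<Longrightarrow> braid_eq m v u"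
| trans: "braid_eq m u v \<Longrightarrow> braid_eq m v w \<Longrightarrow> braid_eq m u w"
| cong: "braid_eq m u u' \<Longrightarrow> braid_eq m v v' \<Longrightarrow> braid_eq m (u @ v) (u' @ v')"
| cancel: "i \<in> {1..<m} \<Longrightarrow> braid_eq m [(i, b), (i, \<not> b)] []"
| far: "i \<in> {1..<m} \<Longrightarrow> j \<in> {1..<m} \<Longrightarrow> i + 2 \<le> j \<or> j + 2 \<le> i \<Longrightarrow>
    braid_eq m [(i, True), (j, True)] [(j, True), (i, True)]"
| braid: "i \<in> {1..<m} \<Longrightarrow> i + 1 \<in> {1..<m} \<Longrightarrow>
    braid_eq m [(i, True), (i + 1, True), (i, True)] [(i + 1, True), (i, True), (i + 1, True)]"

definition braid_rel :: "nat \<Rightarrow> (braid_word \<times> braid_word) set" where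
  "braid_rel m = {(u, v). braid_eq m u v}"

definition braid_group :: "nat \<Rightarrow> braid_word set monoid" where
  "braid_group m =
    \<lparr>carrier = braid_words m // braid_rel m,
     mult = (\<lambda>X Y. \<Union>u\<in>X. \<Union>v\<in>Y. braid_rel m `` {u @ v}),
     one = braid_rel m `` {[]}\<rparr>"

lemma braid_eq_words: "braid_eq m u v \<Longrightarrow> u \<in> braid_words m \<and> v \<in> braid_words m"
  by (induction rule: braid_eq.induct) (auto simp: braid_words_def)

lemma braid_words_append [simp]:
  "u @ v \<in> braid_words m \<longleftrightarrow> u \<in> braid_words m \<and> v \<in> braid_words m"
  by (auto simp: braid_words_def)

lemma braid_words_Nil [simp]: "[] \<in> braid_words m"
  by (simp add: braid_words_def)

lemma equiv_braid_rel: "equiv (braid_words m) (braid_rel m)"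
proof (rule equivI)
  show "braid_rel m \<subseteq> braid_words m \<times> braid_words m"
    by (auto simp: braid_rel_def dest: braid_eq_words)
  show "refl_on (braid_words m) (braid_rel m)"
    by (auto simp: refl_on_def braid_rel_def intro: braid_eq.refl)
  show "Relation.sym (braid_rel m)"
    by (auto simp: sym_def braid_rel_def intro: braid_eq.sym)
  show "Relation.trans (braid_rel m)"
    by (auto simp: trans_def braid_rel_def intro: braid_eq.trans)
qed

lemma braid_group_carrier_cases:
  assumes "X \<in> carrier (braid_group m)"
  obtains u where "u \<in> braid_words m" "X = braid_rel m `` {u}"
  using assms by (auto simp: braid_group_def elim: quotientE)

lemma braid_class_in_carrier:
  "u \<in> braid_words m \<Longrightarrow> braid_rel m `` {u} \<in> carrier (braid_group m)"
  by (auto simp: braid_group_def intro: quotientI)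

lemma braid_class_eqI: "braid_eq m u v \<Longrightarrow> braid_rel m `` {u} = braid_rel m `` {v}"
  by (rule equiv_class_eq[OF equiv_braid_rel]) (simp add: braid_rel_def)

lemma braid_group_mult:
  assumes "u \<in> braid_words m" "v \<in> braid_words m"
  shows "braid_rel m `` {u} \<otimes>\<^bsub>braid_group m\<^esub> braid_rel m `` {v} = braid_rel m `` {u @ v}"
proof -
  have "braid_rel m `` {u' @ v'} = braid_rel m `` {u @ v}"
    if "u' \<in> braid_rel m `` {u}" "v' \<in> braid_rel m `` {v}" for u' v'
    using that by (intro braid_class_eqI) (simp add: braid_rel_def braid_eq.cong braid_eq.sym)
  moreover have "u \<in> braid_rel m `` {u}" "v \<in> braid_rel m `` {v}"
    using assms by (auto simp: braid_rel_def intro: braid_eq.refl)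
  ultimately have "(\<Union>u'\<in>braid_rel m `` {u}. \<Union>v'\<in>braid_rel m `` {v}. braid_rel m `` {u' @ v'})
      = braid_rel m `` {u @ v}"
    by blast
  then show ?thesis
    by (simp add: braid_group_def)
qed

lemma braid_group_one: "\<one>\<^bsub>braid_group m\<^esub> = braid_rel m `` {[]}"
  by (simp add: braid_group_def)

lemma braid_word_left_inverse:
  "w \<in> braid_words m \<Longrightarrow> \<exists>w'\<in>braid_words m. braid_eq m (w' @ w) []"
proof (induction w)
  case Nil
  show ?case by (rule bexI[of _ "[]"]) (simp_all add: braid_eq.refl)
next
  case (Cons a w)
  obtain i b where a: "a = (i, b)" by (cases a)
  have i: "i \<in> {1..<m}" and w: "w \<in> braid_words m"
    using Cons.prems by (auto simp: a braid_words_def)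
  then obtain w' where w': "w' \<in> braid_words m" "braid_eq m (w' @ w) []"
    using Cons.IH by auto
  have "braid_eq m ([(i, \<not> b), (i, b)] @ w) ([] @ w)"
    using braid_eq.cong[OF braid_eq.cancel[OF i, of "\<not> b"] braid_eq.refl[OF w]] by simp
  then have "braid_eq m (w' @ ([(i, \<not> b), (i, b)] @ w)) (w' @ ([] @ w))"
    by (rule braid_eq.cong[OF braid_eq.refl[OF w'(1)]])
  then have "braid_eq m (w' @ ([(i, \<not> b), (i, b)] @ w)) []"
    by (rule braid_eq.trans) (simp add: w'(2))
  then have "braid_eq m ((w' @ [(i, \<not> b)]) @ a # w) []"
    by (simp add: a)
  moreover have "w' @ [(i, \<not> b)] \<in> braid_words m"
    using i w' by (auto simp: braid_words_def)
  ultimately show ?case by blast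
qed

lemma group_braid_group: "group (braid_group m)"
proof (rule groupI)
  show "\<one>\<^bsub>braid_group m\<^esub> \<in> carrier (braid_group m)"
    by (simp add: braid_group_one braid_class_in_carrier)
next
  fix X Y assume "X \<in> carrier (braid_group m)" "Y \<in> carrier (braid_group m)"
  then show "X \<otimes>\<^bsub>braid_group m\<^esub> Y \<in> carrier (braid_group m)"
    by (auto elim!: braid_group_carrier_cases simp: braid_group_mult braid_class_in_carrier)
next
  fix X Y Z
  assume "X \<in> carrier (braid_group m)" "Y \<in> carrier (braid_group m)" "Z \<in> carrier (braid_group m)"
  then show "X \<otimes>\<^bsub>braid_group m\<^esub> Y \<otimes>\<^bsub>braid_group m\<^esub> Z
      = X \<otimes>\<^bsub>braid_group m\<^esub> (Y \<otimes>\<^bsub>braid_group m\<^esub> Z)"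
    by (auto elim!: braid_group_carrier_cases simp: braid_group_mult)
next
  fix X assume "X \<in> carrier (braid_group m)"
  then show "\<one>\<^bsub>braid_group m\<^esub> \<otimes>\<^bsub>braid_group m\<^esub> X = X"
    by (auto elim!: braid_group_carrier_cases simp: braid_group_mult braid_group_one)
next
  fix X assume "X \<in> carrier (braid_group m)"
  then obtain w where w: "w \<in> braid_words m" "X = braid_rel m `` {w}"
    by (rule braid_group_carrier_cases)
  obtain w' where w': "w' \<in> braid_words m" "braid_eq m (w' @ w) []"
    using braid_word_left_inverse[OF w(1)] by blast
  then show "\<exists>Y\<in>carrier (braid_group m). Y \<otimes>\<^bsub>braid_group m\<^esub> X = \<one>\<^bsub>braid_group m\<^esub>"
    using w w' braid_class_eqI[OF w'(2)]
    by (intro bexI[of _ "braid_rel m `` {w'}"])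
      (simp_all add: braid_group_mult braid_group_one braid_class_in_carrier)
qed

definition int_vecs :: "nat \<Rightarrow> int list set" where
  "int_vecs m = {v. length v = m}"

text \<open>The entry \<open>a\<^sub>i\<close> of the tuple is \<open>v ! (i - 1)\<close>.  The second equation is
  the inverse of the first one, see \<open>hurwitz_letter_inverse\<close>.\<close>

fun hurwitz_letter :: "nat \<times> bool \<Rightarrow> int list \<Rightarrow> int list" where
  "hurwitz_letter (i, True) v = v[i - 1 := v ! i, i := 2 * v ! i - v ! (i - 1)]"
| "hurwitz_letter (i, False) v = v[i - 1 := 2 * v ! (i - 1) - v ! i, i := v ! (i - 1)]"

text \<open>Being a right action, it applies the first letter of a word first.\<close>

definition hurwitz_word :: "int list \<Rightarrow> braid_word \<Rightarrow> int list" where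
  "hurwitz_word v u = fold hurwitz_letter u v"

text \<open>A braid is a class of words, all of which act in the same way
  (see \<open>hurwitz_word_cong\<close> and \<open>hurwitz_class\<close>).\<close>

definition hurwitz :: "int list \<Rightarrow> braid_word set \<Rightarrow> int list" where
  "hurwitz v \<beta> = the_elem (hurwitz_word v ` \<beta>)"

definition hurwitz_rel :: "nat \<Rightarrow> (int list \<times> int list) set" where
  "hurwitz_rel m = {(v, w). v \<in> int_vecs m \<and> w \<in> int_vecs m \<and>
     (\<exists>\<beta>\<in>carrier (braid_group m). hurwitz v \<beta> = w)}"

lemma length_hurwitz_letter [simp]: "length (hurwitz_letter l v) = length v"
  by (cases "(l, v)" rule: hurwitz_letter.cases) auto

lemma hurwitz_letter_inverse:
  assumes "i \<in> {1..<length v}"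
  shows "hurwitz_letter (i, \<not> b) (hurwitz_letter (i, b) v) = v"
  using assms by (cases b) (auto simp: list_eq_iff_nth_eq nth_list_update)

lemma hurwitz_word_append: "hurwitz_word v (u @ u') = hurwitz_word (hurwitz_word v u) u'"
  by (simp add: hurwitz_word_def)

lemma hurwitz_word_Nil [simp]: "hurwitz_word v [] = v"
  by (simp add: hurwitz_word_def)

lemma length_hurwitz_word [simp]: "length (hurwitz_word v u) = length v"
  by (induction u arbitrary: v) (auto simp: hurwitz_word_def)

lemma hurwitz_word_cong:
  "braid_eq m u u' \<Longrightarrow> length v = m \<Longrightarrow> hurwitz_word v u = hurwitz_word v u'"
proof (induction arbitrary: v rule: braid_eq.induct)
  case (cancel i b)
  then show ?case by (simp add: hurwitz_word_def hurwitz_letter_inverse)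
next
  case (far i j)
  from far have *: "i - 1 < length v" "i < length v" "j - 1 < length v" "j < length v"
      "i - 1 \<noteq> i" "j - 1 \<noteq> j" "i - 1 \<noteq> j - 1" "i - 1 \<noteq> j" "i \<noteq> j - 1" "i \<noteq> j"
    by auto
  show ?case
    using * *(5-)[symmetric] by (simp add: hurwitz_word_def list_update_swap)
next
  case (braid i)
  then obtain n where n: "i = Suc n" "Suc (Suc n) < length v"
    by (cases i) auto
  then show ?case
    by (simp add: hurwitz_word_def list_update_swap[of "Suc n" n]
        list_update_swap[of "Suc (Suc n)" n] list_update_swap[of "Suc (Suc n)" "Suc n"] algebra_simps)
qed (simp_all add: hurwitz_word_append)

lemma hurwitz_class:
  assumes "u \<in> braid_words m" "length v = m"
  shows "hurwitz v (braid_rel m `` {u}) = hurwitz_word v u"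
proof -
  have "hurwitz_word v ` (braid_rel m `` {u}) = {hurwitz_word v u}"
    using assms by (auto simp: braid_rel_def image_iff dest: hurwitz_word_cong
        intro!: exI[of _ u] braid_eq.refl)
  then show ?thesis by (simp add: hurwitz_def)
qed

lemma hurwitz_one: "length v = m \<Longrightarrow> hurwitz v \<one>\<^bsub>braid_group m\<^esub> = v"
  by (simp add: braid_group_one hurwitz_class)

lemma length_hurwitz:
  "length v = m \<Longrightarrow> \<beta> \<in> carrier (braid_group m) \<Longrightarrow> length (hurwitz v \<beta>) = m"
  by (auto elim!: braid_group_carrier_cases simp: hurwitz_class)

lemma hurwitz_mult:
  assumes "length v = m" "\<beta> \<in> carrier (braid_group m)" "\<gamma> \<in> carrier (braid_group m)"
  shows "hurwitz v (\<beta> \<otimes>\<^bsub>braid_group m\<^esub> \<gamma>) = hurwitz (hurwitz v \<beta>) \<gamma>"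
  using assms
  by (auto elim!: braid_group_carrier_cases simp: braid_group_mult hurwitz_class hurwitz_word_append)

lemma equiv_hurwitz_rel: "equiv (int_vecs m) (hurwitz_rel m)"
proof (rule equivI)
  interpret group "braid_group m" by (rule group_braid_group)
  show "hurwitz_rel m \<subseteq> int_vecs m \<times> int_vecs m"
    by (auto simp: hurwitz_rel_def)
  show "refl_on (int_vecs m) (hurwitz_rel m)"
    using one_closed hurwitz_one[of _ m] unfolding refl_on_def hurwitz_rel_def int_vecs_def by blast
  show "Relation.sym (hurwitz_rel m)"
  proof (rule symI)
    fix v w assume "(v, w) \<in> hurwitz_rel m"
    then obtain \<beta> where *: "length v = m" "length w = m" "\<beta> \<in> carrier (braid_group m)"
        "hurwitz v \<beta> = w"
      by (auto simp: hurwitz_rel_def int_vecs_def)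
    have "hurwitz w (inv\<^bsub>braid_group m\<^esub> \<beta>) = v"
      using hurwitz_mult[of v m \<beta> "inv\<^bsub>braid_group m\<^esub> \<beta>"] * by (simp add: hurwitz_one)
    then show "(w, v) \<in> hurwitz_rel m"
      using * inv_closed unfolding hurwitz_rel_def int_vecs_def by blast
  qed
  show "Relation.trans (hurwitz_rel m)"
  proof (rule transI)
    fix u v w assume "(u, v) \<in> hurwitz_rel m" "(v, w) \<in> hurwitz_rel m"
    then obtain \<beta> \<gamma> where "length u = m" "length v = m" "length w = m"
        "\<beta> \<in> carrier (braid_group m)" "\<gamma> \<in> carrier (braid_group m)"
        "hurwitz u \<beta> = v" "hurwitz v \<gamma> = w"
      by (auto simp: hurwitz_rel_def int_vecs_def)
    then have *: "length u = m" "length w = m"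
        "hurwitz u (\<beta> \<otimes>\<^bsub>braid_group m\<^esub> \<gamma>) = w"
        "\<beta> \<otimes>\<^bsub>braid_group m\<^esub> \<gamma> \<in> carrier (braid_group m)"
      using hurwitz_mult[of u m \<beta> \<gamma>] by simp_all
    then show "(u, w) \<in> hurwitz_rel m"
      unfolding hurwitz_rel_def int_vecs_def by blast
  qed
qed

definition complete_representatives :: "'a set \<Rightarrow> ('a \<times> 'a) set \<Rightarrow> 'a set \<Rightarrow> bool" where
  "complete_representatives A r R \<longleftrightarrow> R \<subseteq> A \<and> (\<forall>c\<in>A // r. \<exists>!x. x \<in> R \<inter> c)"

definition constant_vecs :: "nat \<Rightarrow> int list set" where
  "constant_vecs m = {replicate m x | x. True}"

definition two_block_vecs :: "nat \<Rightarrow> nat \<Rightarrow> int list set" where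
  "two_block_vecs k p =
     {replicate (2 * p - 1) x @ replicate (2 * k - 2 * p) y | x y. x < y}"

end

theory Submission
  imports Defs "HOL-Library.Multiset"
begin

text \<open>A pair \<open>(y, y)\<close> moves past every entry: \<open>(a, y, y) \<sim> (y, y, a)\<close>.  On the two consecutive
  differences of a triple, \<open>\<sigma>\<^sub>1\<close> and \<open>\<sigma>\<^sub>2\<close> act by elementary matrices, so the Euclidean algorithm
  turns every triple into the form \<open>(s, y, y)\<close>, and hence every vector of odd length into
  \<open>(s, y\<^sub>1, y\<^sub>1, \<dots>, y\<^sub>n, y\<^sub>n)\<close>.  Here the pairs may be permuted, and any of them may be reflected at
  \<open>s\<close> or at another pair; a second Euclidean descent on the distances to \<open>s\<close> leaves only the
  values \<open>s\<close> and \<open>s + g\<close>.  Conversely, the alternating sum, the moduli \<open>g\<close> for which all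
  entries are congruent, and, for such a \<open>g\<close>, the number of entries in each class modulo \<open>2 g\<close> are
  invariant, and they determine \<open>s\<close>, \<open>g\<close> and the block lengths.\<close>

section \<open>Equivalence generated by elementary moves\<close>

text \<open>Without indices and braid words, an invariant has to be checked on a single move only,
  and a move can be used inside any longer vector. Inverse generators are covered by
  \<open>sym\<close>.\<close>

inductive hurwitz_equiv :: "int list \<Rightarrow> int list \<Rightarrow> bool" (infix "\<approx>" 50) where
  refl [simp]: "v \<approx> v"
| sym: "v \<approx> w \<Longrightarrow> w \<approx> v"
| trans [trans]: "u \<approx> v \<Longrightarrow> v \<approx> w \<Longrightarrow> u \<approx> w"
| step: "xs @ [a, b] @ ys \<approx> xs @ [b, 2 * b - a] @ ys"

lemma hurwitz_equiv_length: "v \<approx> w \<Longrightarrow> length v = length w"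
  by (induction rule: hurwitz_equiv.induct) auto

lemma hurwitz_letter_append:
  "hurwitz_letter (Suc (length xs), True) (xs @ [a, b] @ ys) = xs @ [b, 2 * b - a] @ ys"
  by (simp add: list_update_append nth_append)

lemma hurwitz_letter_equiv:
  assumes "i \<in> {1..<length v}"
  shows "v \<approx> hurwitz_letter (i, b) v"
proof -
  have pos: "w \<approx> hurwitz_letter (i, True) w" if "length w = length v" for w
  proof -
    have i: "Suc (i - 1) = i" "i - 1 < length w" "i < length w"
      using assms that by auto
    have "w = take (i - 1) w @ [w ! (i - 1), w ! i] @ drop (Suc i) w"
      using i by (metis Cons_nth_drop_Suc append_Cons append_Nil append_take_drop_id)
    moreover have "i = Suc (length (take (i - 1) w))"
      using i by simp
    ultimately show ?thesis
      using step hurwitz_letter_append by metis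
  qed
  show ?thesis
  proof (cases b)
    case True
    then show ?thesis using pos[of v] by simp
  next
    case False
    \<comment> \<open>An inverse letter is undone by the positive one, so a positive move leads from
      its result back to \<open>v\<close>.\<close>
    then show ?thesis
      using pos[of "hurwitz_letter (i, b) v"] hurwitz_letter_inverse[OF assms, of b]
      by (simp add: hurwitz_equiv.sym)
  qed
qed

lemma hurwitz_word_equiv: "u \<in> braid_words (length v) \<Longrightarrow> v \<approx> hurwitz_word v u"
proof (induction u arbitrary: v)
  case (Cons l u)
  obtain i b where l: "l = (i, b)" by (cases l)
  have "v \<approx> hurwitz_letter l v"
    using Cons.prems by (auto simp: l braid_words_def intro: hurwitz_letter_equiv)
  also have "\<dots> \<approx> hurwitz_word (hurwitz_letter l v) u"
    using Cons by (simp add: braid_words_def)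
  finally show ?case by (simp add: hurwitz_word_def)
qed simp

lemma hurwitz_rel_step:
  assumes "m = length (xs @ [a, b] @ ys)"
  shows "(xs @ [a, b] @ ys, xs @ [b, 2 * b - a] @ ys) \<in> hurwitz_rel m"
proof -
  let ?u = "[(Suc (length xs), True)]"
  have u: "?u \<in> braid_words m"
    using assms by (auto simp: braid_words_def)
  have "hurwitz_word (xs @ [a, b] @ ys) ?u = xs @ [b, 2 * b - a] @ ys"
    by (simp only: hurwitz_word_def fold_simps hurwitz_letter_append)
  then have "hurwitz (xs @ [a, b] @ ys) (braid_rel m `` {?u}) = xs @ [b, 2 * b - a] @ ys"
    using hurwitz_class[OF u] assms by simp
  then show ?thesis
    using braid_class_in_carrier[OF u] assms unfolding hurwitz_rel_def int_vecs_def by auto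
qed

text \<open>A braid acts letter by letter, each letter being a move or its inverse. Conversely, a
  move is a one-letter braid, and the orbit relation is already closed under the other
  rules.\<close>

lemma hurwitz_rel_iff: "(v, w) \<in> hurwitz_rel m \<longleftrightarrow> length v = m \<and> v \<approx> w"
proof
  assume "(v, w) \<in> hurwitz_rel m"
  then show "length v = m \<and> v \<approx> w"
    by (auto simp: hurwitz_rel_def int_vecs_def hurwitz_class hurwitz_word_equiv
        elim!: braid_group_carrier_cases)
next
  have "v \<approx> w \<Longrightarrow> (v, w) \<in> hurwitz_rel (length v)"
  proof (induction rule: hurwitz_equiv.induct)
    case (refl v)
    then show ?case
      using equiv_hurwitz_rel[of "length v"] by (auto simp: equiv_def refl_on_def int_vecs_def)
  next
    case (sym v w)
    then show ?case
      using equiv_hurwitz_rel[of "length v"] hurwitz_equiv_length[of v w]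
      by (auto simp: equiv_def dest: symD)
  next
    case (trans u v w)
    then show ?case
      using equiv_hurwitz_rel[of "length v"] hurwitz_equiv_length[of u v]
      by (auto simp: equiv_def dest: transD)
  next
    case (step xs a b ys)
    show ?case by (rule hurwitz_rel_step) simp
  qed
  then show "length v = m \<and> v \<approx> w \<Longrightarrow> (v, w) \<in> hurwitz_rel m" by blast
qed

section \<open>Invariants\<close>

fun alt_sum :: "int list \<Rightarrow> int" where
  "alt_sum [] = 0"
| "alt_sum (a # v) = a - alt_sum v"

lemma alt_sum_append_cong: "alt_sum v = alt_sum w \<Longrightarrow> alt_sum (xs @ v) = alt_sum (xs @ w)"
  by (induction xs) auto

text \<open>A move preserves the difference of the two entries it touches: b - (2b - a) = a -
  b.\<close>

lemma hurwitz_equiv_alt_sum: "v \<approx> w \<Longrightarrow> alt_sum v = alt_sum w"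
  by (induction rule: hurwitz_equiv.induct) (auto intro!: alt_sum_append_cong)

definition all_cong :: "int \<Rightarrow> int list \<Rightarrow> bool" where
  "all_cong g v \<longleftrightarrow> (\<exists>r. \<forall>a\<in>set v. g dvd a - r)"

lemma hurwitz_equiv_all_cong: "v \<approx> w \<Longrightarrow> all_cong g v \<longleftrightarrow> all_cong g w"
proof (induction rule: hurwitz_equiv.induct)
  case (step xs a b ys)
  have "g dvd b - r \<Longrightarrow> g dvd a - r \<longleftrightarrow> g dvd 2 * b - a - r" for r
  proof -
    assume "g dvd b - r"
    then have "g dvd 2 * (b - r) - (a - r) \<longleftrightarrow> g dvd a - r"
      by (intro dvd_diff_right_iff dvd_mult)
    moreover have "2 * (b - r) - (a - r) = 2 * b - a - r" by simp
    ultimately show ?thesis by metis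
  qed
  then show ?case by (auto simp: all_cong_def)
qed auto

text \<open>The new entry 2b - a differs from a by 2(b - a), a multiple of 2g since a and b agree
  modulo g. So a move only permutes the residues modulo 2g.\<close>

lemma hurwitz_equiv_count_class:
  "v \<approx> w \<Longrightarrow> all_cong g v \<Longrightarrow>
    length (filter (\<lambda>a. 2 * g dvd a - r) v) = length (filter (\<lambda>a. 2 * g dvd a - r) w)"
proof (induction rule: hurwitz_equiv.induct)
  case (step xs a b ys)
  then obtain q where "g dvd a - q" "g dvd b - q"
    by (auto simp: all_cong_def)
  then have "g dvd (b - q) - (a - q)" by (rule dvd_diff[rotated])
  then have "2 * g dvd 2 * (b - a)"
    by (intro mult_dvd_mono) simp_all
  then have "2 * g dvd 2 * (b - a) + (a - r) \<longleftrightarrow> 2 * g dvd a - r"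
    by (rule dvd_add_right_iff)
  then have "2 * g dvd 2 * b - a - r \<longleftrightarrow> 2 * g dvd a - r"
    by (simp add: algebra_simps)
  then show ?case by simp
qed (auto simp: hurwitz_equiv_all_cong)

section \<open>Reduction to pairs\<close>

lemma hurwitz_equiv_context: "v \<approx> w \<Longrightarrow> xs @ v @ ys \<approx> xs @ w @ ys"
proof (induction rule: hurwitz_equiv.induct)
  case (step us a b vs)
  then show ?case using hurwitz_equiv.step[of "xs @ us" a b "vs @ ys"] by simp
qed (auto intro: hurwitz_equiv.sym hurwitz_equiv.trans)

lemmas hurwitz_equiv_append_left = hurwitz_equiv_context[where ys = "[]", simplified]
lemmas hurwitz_equiv_append_right = hurwitz_equiv_context[where xs = "[]", simplified]

lemma hurwitz_equiv_Cons: "v \<approx> w \<Longrightarrow> a # v \<approx> a # w"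
  using hurwitz_equiv_append_left[of v w "[a]"] by simp

text \<open>An entry crossing y is reflected at y; crossing two equal entries reflects it twice and
  restores it.\<close>

lemma hurwitz_equiv_move_pair: "[y, y] @ xs \<approx> xs @ [y, y]"
proof (induction xs)
  case (Cons a xs)
  have "a # y # y # xs \<approx> y # (2 * y - a) # y # xs"
    using step[of "[]" a y "y # xs"] by simp
  also have "\<dots> \<approx> y # y # a # xs"
    using step[of "[y]" "2 * y - a" y xs] by simp
  finally have "[y, y] @ a # xs \<approx> a # [y, y] @ xs"
    by (simp add: hurwitz_equiv.sym)
  also have "\<dots> \<approx> a # xs @ [y, y]"
    by (rule hurwitz_equiv_Cons[OF Cons])
  finally show ?case by simp
qed simp

text \<open>Moving a to the right by inverse moves reflects each z at a; the reflected pair then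
  passes back over a unchanged.\<close>

lemma hurwitz_equiv_reflect_pair: "[a, z, z] \<approx> [a, 2 * a - z, 2 * a - z]"
proof -
  have "[a, z, z] \<approx> [2 * a - z, a, z]"
    using hurwitz_equiv.sym[OF step[of "[]" "2 * a - z" a "[z]"]] by simp
  also have "\<dots> \<approx> [2 * a - z, 2 * a - z, a]"
    using hurwitz_equiv.sym[OF step[of "[2 * a - z]" "2 * a - z" a "[]"]] by simp
  also have "\<dots> \<approx> [a, 2 * a - z, 2 * a - z]"
    using hurwitz_equiv_move_pair[of "2 * a - z" "[a]"] by simp
  finally show ?thesis .
qed

text \<open>With p = b - a and q = c - b, the moves \<open>s1\<close>, \<open>s1'\<close>,
  \<open>s2\<close>, \<open>s2'\<close> turn (p, q) into (p, q - p), (p, p + q), (p + q, q), (p - q,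
  q). The descent on |p| + |q| stops once p or q vanishes.\<close>

lemma triple_equiv_pair: "\<exists>s y. [a, b, c] \<approx> [s, y, y]"
proof (induction "nat (\<bar>b - a\<bar> + \<bar>c - b\<bar>)" arbitrary: a b c rule: less_induct)
  case less
  have red: ?case if "[a, b, c] \<approx> [a', b', c']"
      "\<bar>b' - a'\<bar> + \<bar>c' - b'\<bar> < \<bar>b - a\<bar> + \<bar>c - b\<bar>" for a' b' c'
  proof -
    have "nat (\<bar>b' - a'\<bar> + \<bar>c' - b'\<bar>) < nat (\<bar>b - a\<bar> + \<bar>c - b\<bar>)"
      using that(2) by simp
    from less.hyps[OF this] show ?thesis
      using that(1) hurwitz_equiv.trans by blast
  qed
  have s1: "[a, b, c] \<approx> [b, 2 * b - a, c]" using step[of "[]" a b "[c]"] by simp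
  have s1': "[a, b, c] \<approx> [2 * a - b, a, c]"
    using hurwitz_equiv.sym[OF step[of "[]" "2 * a - b" a "[c]"]] by simp
  have s2: "[a, b, c] \<approx> [a, c, 2 * c - b]" using step[of "[a]" b c "[]"] by simp
  have s2': "[a, b, c] \<approx> [a, 2 * b - c, b]"
    using hurwitz_equiv.sym[OF step[of "[a]" "2 * b - c" b "[]"]] by simp
  consider "b = c" | "a = b" "b \<noteq> c" | "a \<noteq> b" "b \<noteq> c" by blast
  then show ?case
  proof cases
    case 1
    then show ?thesis by (metis hurwitz_equiv.refl)
  next
    case 2
    then show ?thesis
      using hurwitz_equiv_move_pair[of b "[c]"] by auto
  next
    case 3
    \<comment> \<open>If p and q are nonzero, adding or subtracting the one of smaller absolute
      value makes the other strictly smaller; for |p| = |q| it becomes 0.\<close>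
    then have "\<bar>c - 2 * b + a\<bar> < \<bar>c - b\<bar> \<or> \<bar>c - a\<bar> < \<bar>c - b\<bar> \<or> \<bar>c - a\<bar> < \<bar>b - a\<bar>
        \<or> \<bar>2 * b - c - a\<bar> < \<bar>b - a\<bar>"
      by linarith
    then show ?thesis
    proof (elim disjE)
      assume "\<bar>c - 2 * b + a\<bar> < \<bar>c - b\<bar>"
      then show ?thesis by (intro red[OF s1]) linarith
    next
      assume "\<bar>c - a\<bar> < \<bar>c - b\<bar>"
      then show ?thesis by (intro red[OF s1']) linarith
    next
      assume "\<bar>c - a\<bar> < \<bar>b - a\<bar>"
      then show ?thesis by (intro red[OF s2]) linarith
    next
      assume "\<bar>2 * b - c - a\<bar> < \<bar>b - a\<bar>"
      then show ?thesis by (intro red[OF s2']) linarith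
    qed
  qed
qed

definition doubled :: "'a list \<Rightarrow> 'a list" where
  "doubled ys = concat (map (\<lambda>y. [y, y]) ys)"

lemma doubled_simps [simp]:
  "doubled [] = []" "doubled (y # ys) = y # y # doubled ys"
  "doubled (xs @ ys) = doubled xs @ doubled ys"
  by (simp_all add: doubled_def)

lemma doubled_replicate [simp]: "doubled (replicate n y) = replicate (2 * n) y"
  by (induction n) simp_all

text \<open>The pair split off from the first three entries is parked in front, which leaves a
  vector shorter by two; after the induction step it returns behind s.\<close>

lemma odd_length_equiv_doubled: "length v = Suc (2 * n) \<Longrightarrow> \<exists>s ys. v \<approx> s # doubled ys"
proof (induction n arbitrary: v)
  case 0
  then obtain s where "v = s # doubled []" by (auto simp: length_Suc_conv)
  then show ?case by (metis hurwitz_equiv.refl)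
next
  case (Suc n)
  then obtain a b c rest where v: "v = [a, b, c] @ rest" "length rest = 2 * n"
    by (auto simp: length_Suc_conv)
  obtain t y where "[a, b, c] \<approx> [t, y, y]" using triple_equiv_pair by blast
  then have "v \<approx> [t, y, y] @ rest"
    using v hurwitz_equiv_append_right by metis
  also have "\<dots> \<approx> [y, y] @ t # rest"
    using hurwitz_equiv_append_right[OF hurwitz_equiv.sym[OF hurwitz_equiv_move_pair[of y "[t]"]]]
    by simp
  finally have *: "v \<approx> [y, y] @ t # rest" .
  obtain s ys where "t # rest \<approx> s # doubled ys"
    using Suc.IH[of "t # rest"] v by auto
  then have "[y, y] @ t # rest \<approx> [y, y] @ s # doubled ys"
    by (rule hurwitz_equiv_append_left)
  also have "\<dots> \<approx> s # doubled (y # ys)"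
    using hurwitz_equiv_append_right[OF hurwitz_equiv_move_pair[of y "[s]"]] by simp
  finally show ?case using * hurwitz_equiv.trans by blast
qed

section \<open>Reduction to two values\<close>

lemma doubled_equiv_mset: "mset ys = mset zs \<Longrightarrow> doubled ys \<approx> doubled zs"
proof (induction ys arbitrary: zs)
  case (Cons y ys)
  then have "y \<in> set zs" by (metis list.set_intros(1) mset_eq_setD)
  then obtain us vs where zs: "zs = us @ y # vs" by (meson split_list)
  then have "mset ys = mset (us @ vs)" using Cons.prems by simp
  then have "doubled ys \<approx> doubled (us @ vs)" by (rule Cons.IH)
  then have "doubled (y # ys) \<approx> y # y # doubled us @ doubled vs"
    by (simp add: hurwitz_equiv_Cons)
  also have "\<dots> \<approx> doubled zs"
    using hurwitz_equiv_append_right[OF hurwitz_equiv_move_pair[of y "doubled us"]]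
    by (simp add: zs)
  finally show ?case .
qed simp

lemma equiv_reflect_first: "s # doubled (y # ys) \<approx> s # doubled ((2 * s - y) # ys)"
  using hurwitz_equiv_append_right[OF hurwitz_equiv_reflect_pair] by simp

text \<open>Only the pair next to s can be reflected at s directly. Once treated, it is moved in
  front of s, so that s meets the next pair.\<close>

lemma equiv_all_above: "s # doubled ys \<approx> s # doubled (map (\<lambda>y. s + \<bar>y - s\<bar>) ys)"
proof (induction ys)
  case (Cons y ys)
  let ?y = "s + \<bar>y - s\<bar>" and ?ys = "map (\<lambda>y. s + \<bar>y - s\<bar>) ys"
  have "?y = y \<or> ?y = 2 * s - y" by auto
  then have "s # doubled (y # ys) \<approx> s # doubled (?y # ys)"
    by (metis equiv_reflect_first hurwitz_equiv.refl)
  also have "\<dots> \<approx> [?y, ?y] @ s # doubled ys"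
    using hurwitz_equiv_append_right[OF hurwitz_equiv.sym[OF hurwitz_equiv_move_pair[of ?y "[s]"]]]
    by simp
  also have "\<dots> \<approx> [?y, ?y] @ s # doubled ?ys"
    by (rule hurwitz_equiv_append_left[OF Cons])
  also have "\<dots> \<approx> s # doubled (?y # ?ys)"
    using hurwitz_equiv_append_right[OF hurwitz_equiv_move_pair[of ?y "[s]"]] by simp
  finally show ?case by simp
qed simp

lemma equiv_two_values:
  "\<exists>g zs. g \<ge> 0 \<and> set zs \<subseteq> {s, s + g} \<and> s # doubled ys \<approx> s # doubled zs"
proof (induction "\<Sum>y\<leftarrow>ys. nat \<bar>y - s\<bar>" arbitrary: ys rule: less_induct)
  case less
  define ws where "ws = map (\<lambda>y. s + \<bar>y - s\<bar>) ys"
  have ws: "s # doubled ys \<approx> s # doubled ws"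
    unfolding ws_def by (rule equiv_all_above)
  have above: "y \<ge> s" if "y \<in> set ws" for y using that by (auto simp: ws_def)
  show ?case
  proof (cases "\<exists>y\<in>set ws. \<exists>z\<in>set ws. s < y \<and> y < z")
    case True
    then obtain y z where yz: "y \<in> set ws" "z \<in> set ws" "s < y" "y < z" by blast
    then obtain us where us: "mset ws = mset (y # z # us)"
      by (metis ex_mset less_irrefl mset.simps(2) multi_member_split insert_noteq_member
          set_mset_mset)
    have "s # doubled ws \<approx> s # doubled (y # z # us)"
      by (rule hurwitz_equiv_Cons[OF doubled_equiv_mset[OF us]])
    \<comment> \<open>The pair of z is reflected at the adjacent y. From s < y < z follows |2y - z -
      s| < z - s, so the sum of distances to s drops.\<close>
    also have "\<dots> \<approx> s # doubled (y # (2 * y - z) # us)"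
      using hurwitz_equiv_context[OF hurwitz_equiv_reflect_pair[of y z], of "[s, y]"] by simp
    finally have *: "s # doubled ws \<approx> s # doubled (y # (2 * y - z) # us)" .
    have "(\<Sum>y\<leftarrow>ys. nat \<bar>y - s\<bar>) = (\<Sum>y\<leftarrow>ws. nat \<bar>y - s\<bar>)"
      by (simp add: ws_def o_def)
    moreover have "mset (map (\<lambda>y. nat \<bar>y - s\<bar>) ws) = mset (map (\<lambda>y. nat \<bar>y - s\<bar>) (y # z # us))"
      using us by simp
    then have "(\<Sum>y\<leftarrow>ws. nat \<bar>y - s\<bar>) = (\<Sum>y\<leftarrow>y # z # us. nat \<bar>y - s\<bar>)"
      by (metis sum_mset_sum_list)
    ultimately have "(\<Sum>y\<leftarrow>y # (2 * y - z) # us. nat \<bar>y - s\<bar>) < (\<Sum>y\<leftarrow>ys. nat \<bar>y - s\<bar>)"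
      using yz by simp
    from less.hyps[OF this] show ?thesis
      using ws * hurwitz_equiv.trans by blast
  next
    case False
    show ?thesis
    proof (cases "set ws \<subseteq> {s}")
      case True
      then show ?thesis using ws by (intro exI[of _ 0] exI[of _ ws]) auto
    next
      case nonconst: False
      then obtain y where y: "y \<in> set ws" "y \<noteq> s" by blast
      have "z = y" if "z \<in> set ws" "z \<noteq> s" for z
      proof -
        have "s < y" "s < z" using above[of y] above[of z] y that by auto
        then show ?thesis using False y(1) that(1) by (meson linorder_neqE_linordered_idom)
      qed
      then have "set ws \<subseteq> {s, s + (y - s)}" by auto
      then show ?thesis
        using ws above[OF y(1)] by (intro exI[of _ "y - s"] exI[of _ ws]) auto
    qed
  qed
qed

section \<open>Normal forms\<close>

text \<open>Allowing x = y puts the constant vectors into the same family; in that case p is not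
  determined.\<close>

definition two_blocks :: "nat \<Rightarrow> nat \<Rightarrow> int \<Rightarrow> int \<Rightarrow> int list" where
  "two_blocks k p x y = replicate (2 * p - 1) x @ replicate (2 * k - 2 * p) y"

lemma two_blocks_const:
  "p \<in> {1..k - 1} \<Longrightarrow> two_blocks k p x x = replicate (2 * k - 1) x"
  by (auto simp: two_blocks_def replicate_add[symmetric] intro!: arg_cong[of _ _ "\<lambda>n. replicate n x"])

lemma equiv_two_blocks:
  assumes "k \<ge> 2" "length v = 2 * k - 1"
  shows "\<exists>p\<in>{1..k - 1}. \<exists>x y. x \<le> y \<and> v \<approx> two_blocks k p x y"
proof -
  have "length v = Suc (2 * (k - 1))" using assms by simp
  then obtain s ys where "v \<approx> s # doubled ys"
    using odd_length_equiv_doubled by blast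
  moreover obtain g zs where g: "g \<ge> 0" "set zs \<subseteq> {s, s + g}" "s # doubled ys \<approx> s # doubled zs"
    using equiv_two_values by blast
  ultimately have v: "v \<approx> s # doubled zs"
    using hurwitz_equiv.trans by blast
  define n where "n = length (filter (\<lambda>z. z = s) zs)"
  define l where "l = length (filter (\<lambda>z. z \<noteq> s) zs)"
  have "filter (\<lambda>z. z = s) zs = replicate n s" "filter (\<lambda>z. z \<noteq> s) zs = replicate l (s + g)"
    using g(2) by (auto simp: n_def l_def intro!: replicate_length_same[symmetric])
  then have "mset zs = mset (replicate n s @ replicate l (s + g))"
    by (metis mset_append mset_filter multiset_partition)
  from hurwitz_equiv_Cons[OF doubled_equiv_mset[OF this], of s]
  have "v \<approx> s # replicate (2 * n) s @ replicate (2 * l) (s + g)"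
    using hurwitz_equiv.trans[OF v] by simp
  \<comment> \<open>The single s joins its n pairs in a block of length 2n + 1, hence p = n +
    1.\<close>
  then have v: "v \<approx> replicate (2 * Suc n - 1) s @ replicate (2 * l) (s + g)"
    by simp
  have nl: "n + l = k - 1"
    using hurwitz_equiv_length[OF v] assms by simp
  show ?thesis
  \<comment> \<open>For l = 0 this p would be k, out of range; the vector is constant, and p = 1
    with x = y = s serves instead.\<close>
  proof (cases "l = 0")
    case True
    have "2 * Suc n - 1 = 2 * k - 1" and one: "1 \<in> {1..k - 1}"
      using nl True assms(1) by auto
    then have "v \<approx> two_blocks k 1 s s"
      using v True by (simp only: two_blocks_const) simp
    then show ?thesis
      using one by blast
  next
    case False
    then have "2 * k - 2 * Suc n = 2 * l" "Suc n \<in> {1..k - 1}" using nl by auto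
    then show ?thesis
      using v g(1) by (intro bexI[of _ "Suc n"] exI[of _ s] exI[of _ "s + g"])
        (simp_all add: two_blocks_def)
  qed
qed

section \<open>Invariants of the normal forms\<close>

lemma alt_sum_replicate_double: "alt_sum (replicate (2 * n) x @ v) = alt_sum v"
  by (induction n) auto

lemma alt_sum_two_blocks:
  assumes "p \<ge> 1"
  shows "alt_sum (two_blocks k p x y) = x"
proof -
  obtain q where "p = Suc q" using assms by (cases p) auto
  moreover have "alt_sum (replicate (2 * (k - p)) y) = 0"
    using alt_sum_replicate_double[of "k - p" y "[]"] by simp
  ultimately show ?thesis
    using alt_sum_replicate_double[of q x]
    by (simp add: two_blocks_def diff_mult_distrib2)
qed

lemma all_cong_two_blocks:
  assumes "p \<in> {1..k - 1}"
  shows "all_cong g (two_blocks k p x y) \<longleftrightarrow> g dvd y - x"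
proof
  have "x \<in> set (two_blocks k p x y)" "y \<in> set (two_blocks k p x y)"
    using assms by (auto simp: two_blocks_def)
  moreover assume "all_cong g (two_blocks k p x y)"
  ultimately obtain r where "g dvd x - r" "g dvd y - r"
    by (auto simp: all_cong_def)
  then have "g dvd (y - r) - (x - r)" by (rule dvd_diff[rotated])
  then show "g dvd y - x" by simp
next
  assume "g dvd y - x"
  then show "all_cong g (two_blocks k p x y)"
    by (auto simp: all_cong_def two_blocks_def intro!: exI[of _ x])
qed

text \<open>The alternating sum yields x, the admissible moduli yield y - x, and a count modulo 2(y
  - x) yields p.\<close>

lemma two_blocks_equiv_unique:
  assumes "two_blocks k p x y \<approx> two_blocks k q x' y'"
    and "p \<in> {1..k - 1}" "q \<in> {1..k - 1}" "x \<le> y" "x' \<le> y'"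
  shows "x = x' \<and> y = y' \<and> (x < y \<longrightarrow> p = q)"
proof -
  have x: "x = x'"
    using hurwitz_equiv_alt_sum[OF assms(1)] assms(2,3) by (simp add: alt_sum_two_blocks)
  have "g dvd y - x \<longleftrightarrow> g dvd y' - x'" for g
    using hurwitz_equiv_all_cong[OF assms(1)] assms(2,3) by (simp add: all_cong_two_blocks)
  \<comment> \<open>Each of the two gaps is itself taken as the modulus g.\<close>
  then have "y - x dvd y' - x'" "y' - x' dvd y - x"
    by (metis dvd_refl)+
  then have "y - x = y' - x'"
    using assms(4,5) by (intro zdvd_antisym_nonneg) auto
  with x have y: "y = y'" by simp
  have "p = q" if "x < y"
  proof -
    \<comment> \<open>Both values agree modulo y - x, but twice this modulus separates them: only
      the 2p - 1 entries x are counted.\<close>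
    let ?P = "\<lambda>a. 2 * (y - x) dvd a - x"
    have "\<not> ?P y" using that zdvd_not_zless[of "y - x" "2 * (y - x)"] by auto
    then have count: "length (filter ?P (two_blocks k p' x y)) = 2 * p' - 1" for p'
      by (simp add: two_blocks_def)
    have "2 * p - 1 = length (filter ?P (two_blocks k p x y))"
      by (simp only: count)
    also have "\<dots> = length (filter ?P (two_blocks k q x' y'))"
      using assms(1,2) by (intro hurwitz_equiv_count_class) (simp_all add: all_cong_two_blocks)
    also have "\<dots> = 2 * q - 1"
      by (simp only: x[symmetric] y[symmetric] count)
    finally have "2 * p - 1 = 2 * q - 1" .
    then show ?thesis using assms(2,3) by auto
  qed
  with x y show ?thesis by blast
qed

lemma representatives_eq_two_blocks:
  assumes "k \<ge> 2"
  shows "constant_vecs (2 * k - 1) \<union> (\<Union>p\<in>{1..k - 1}. two_block_vecs k p) =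
    {two_blocks k p x y | p x y. p \<in> {1..k - 1} \<and> x \<le> y}" (is "?L = ?R")
proof
  have "replicate (2 * k - 1) x \<in> ?R" for x
  proof -
    have "1 \<in> {1..k - 1}" using assms by simp
    with two_blocks_const[OF this, of x] show ?thesis
      by (metis (mono_tags, lifting) mem_Collect_eq order_refl)
  qed
  then show "?L \<subseteq> ?R"
    by (fastforce simp: constant_vecs_def two_block_vecs_def two_blocks_def)
  show "?R \<subseteq> ?L"
  proof
    fix v assume "v \<in> ?R"
    then obtain p x y where v: "v = two_blocks k p x y" "p \<in> {1..k - 1}" "x \<le> y" by blast
    then show "v \<in> ?L"
    proof (cases "x = y")
      case True
      then show ?thesis using v by (auto simp: two_blocks_const constant_vecs_def)
    next
      case False
      then have "v \<in> two_block_vecs k p"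
        using v by (auto simp: two_block_vecs_def two_blocks_def)
      then show ?thesis using v by blast
    qed
  qed
qed

theorem proposition4p9:
  fixes k :: nat
  assumes "k \<ge> 2"
  shows "complete_representatives (int_vecs (2 * k - 1)) (hurwitz_rel (2 * k - 1))
      (constant_vecs (2 * k - 1) \<union> (\<Union>p\<in>{1..k - 1}. two_block_vecs k p))
    \<and> disjoint_family_on (two_block_vecs k) {1..k - 1}
    \<and> constant_vecs (2 * k - 1) \<inter> (\<Union>p\<in>{1..k - 1}. two_block_vecs k p) = {}"
proof (intro conjI)
  let ?m = "2 * k - 1"
  let ?R = "{two_blocks k p x y | p x y. p \<in> {1..k - 1} \<and> x \<le> y}"
  have unique: "v = w" if "v \<in> ?R" "w \<in> ?R" "v \<approx> w" for v w
  proof -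
    obtain p x y q x' y' where v: "v = two_blocks k p x y" "p \<in> {1..k - 1}" "x \<le> y"
      and w: "w = two_blocks k q x' y'" "q \<in> {1..k - 1}" "x' \<le> y'"
      using \<open>v \<in> ?R\<close> \<open>w \<in> ?R\<close> by blast
    have "x = x' \<and> y = y' \<and> (x < y \<longrightarrow> p = q)"
      using two_blocks_equiv_unique v w \<open>v \<approx> w\<close> by simp
    \<comment> \<open>The block parameter may differ only for x = y, where both vectors are the same
      constant vector.\<close>
    then show ?thesis
      using v w two_blocks_const by (cases "x = y") auto
  qed
  have "complete_representatives (int_vecs ?m) (hurwitz_rel ?m) ?R"
    unfolding complete_representatives_def
  proof (intro conjI ballI)
    show "?R \<subseteq> int_vecs ?m"
      by (auto simp: int_vecs_def two_blocks_def)
  next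
    fix c assume "c \<in> int_vecs ?m // hurwitz_rel ?m"
    then obtain v where v: "length v = ?m" and "c = hurwitz_rel ?m `` {v}"
      by (auto simp: int_vecs_def elim: quotientE)
    then have c: "c = {w. v \<approx> w}"
      by (simp add: Image_singleton hurwitz_rel_iff)
    obtain w where w: "w \<in> ?R" "v \<approx> w"
      using equiv_two_blocks[OF assms v] by blast
    show "\<exists>!w. w \<in> ?R \<inter> c"
    proof (rule ex1I)
      show "w \<in> ?R \<inter> c" using w c by blast
    next
      fix u assume u: "u \<in> ?R \<inter> c"
      then have "v \<approx> u" using c by blast
      then have "u \<approx> w" using w(2) hurwitz_equiv.sym hurwitz_equiv.trans by metis
      with u w(1) show "u = w" by (intro unique) blast+
    qed
  qed
  then show "complete_representatives (int_vecs ?m) (hurwitz_rel ?m)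
      (constant_vecs ?m \<union> (\<Union>p\<in>{1..k - 1}. two_block_vecs k p))"
    using representatives_eq_two_blocks[OF assms] by simp
next
  show "disjoint_family_on (two_block_vecs k) {1..k - 1}"
    unfolding disjoint_family_on_def
  proof (intro ballI impI)
    fix p q assume pq: "p \<in> {1..k - 1}" "q \<in> {1..k - 1}" "p \<noteq> q"
    \<comment> \<open>Equal vectors are equivalent, so the uniqueness result applies to
      them.\<close>
    have "two_blocks k p x y \<noteq> two_blocks k q x' y'" if "x < y" "x' < y'" for x y x' y'
      using two_blocks_equiv_unique[of k p x y q x' y'] pq that
      by (metis hurwitz_equiv.refl order_less_imp_le)
    then show "two_block_vecs k p \<inter> two_block_vecs k q = {}"
      unfolding two_block_vecs_def two_blocks_def by blast
  qed
next
  \<comment> \<open>The constant vector is read as \<open>two_blocks k p z z\<close>; equality would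
    force x = z = y.\<close>
  have "replicate (2 * k - 1) z \<noteq> two_blocks k p x y" if "p \<in> {1..k - 1}" "x < y" for p x y z
    using two_blocks_equiv_unique[of k p x y p z z] that by (auto simp: two_blocks_const)
  then show "constant_vecs (2 * k - 1) \<inter> (\<Union>p\<in>{1..k - 1}. two_block_vecs k p) = {}"
    unfolding constant_vecs_def two_block_vecs_def two_blocks_def by blast
qed

end
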